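(* (Hausdorff-distance formulation of the incremental problem for rectified linear units.) Let $p \in [1,2]$ and $q \in [2,\infty]$ with $1/p + 1/q = 1$, let $z_1,\dots,z_n \in \mathbb{R}^{d+1}$ and $y \in \mathbb{R}^n$. Let $I_+ = \{i : y_i \geq 0\}$, $I_- = \{i : y_i < 0\}$, $t_i = |y_i| z_i$, and let $T_+$ (resp. $T_-$) be the matrix with rows $t_i^\top$, $i \in I_+$ (resp. $i \in I_-$). Then $$\max_{\|v\|_p \leq 1} \sum_{i=1}^n y_i (v^\top z_i)_+ = \max_{b_+ \in [0,1]^{I_+}} \ \min_{b_- \in [0,1]^{I_-}} \big\| T_+^\top b_+ - T_-^\top b_- \big\|_q ,$$ and $$\max_{\|v\|_p \leq 1} \Big| \sum_{i=1}^n y_i (v^\top z_i)_+ \Big|$$ is equal to the Hausdorff distance, for the $\ell_q$-norm, between the two zonotopes $K_+ = \{T_+^\top b_+ : b_+ \in [0,1]^{I_+}\}$ and $K_- = \{T_-^\top b_- : b_- \in [0,1]^{I_-}\}$.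
   Context: $(u)_+ = \max\{u,0\}$. The Hausdorff distance between compact sets $K_+, K_-$ for the $\ell_q$-norm is $\max\big\{ \max_{a \in K_+}\min_{c \in K_-} \|a-c\|_q,\ \max_{c \in K_-}\min_{a \in K_+} \|a-c\|_q \big\}$. If $I_+$ (resp. $I_-$) is empty, $K_+$ (resp. $K_-$) is $\{0\}$. *)

theory Defs
  imports "HOL-Analysis.Analysis"
begin

definition lnorm :: "ereal \<Rightarrow> real ^ 'd \<Rightarrow> real" where
  "lnorm r x =
     (if r = \<infinity> then infnorm x
      else (\<Sum>j\<in>UNIV. \<bar>x $ j\<bar> powr real_of_ereal r) powr (1 / real_of_ereal r))"

text \<open>The cube \<open>[0,1]\<^sup>I\<close>, as extensional functions on \<open>I\<close>; for empty \<open>I\<close> it has exactly one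
  element.\<close>

definition cube :: "'i set \<Rightarrow> ('i \<Rightarrow> real) set" where
  "cube I = (I \<rightarrow>\<^sub>E {0..1})"

text \<open>A matrix with rows indexed by \<open>I\<close> is given by its rows \<open>T i\<close> for \<open>i \<in> I\<close>; this is the product of
  its transpose with the vector \<open>b\<close>.\<close>

definition transpose_mult :: "'i set \<Rightarrow> ('i \<Rightarrow> real ^ 'd) \<Rightarrow> ('i \<Rightarrow> real) \<Rightarrow> real ^ 'd" where
  "transpose_mult I T b = (\<chi> j. \<Sum>i\<in>I. T i $ j * b i)"

text \<open>For empty \<open>I\<close> this is \<open>{0}\<close>.\<close>

definition zonotope :: "'i set \<Rightarrow> ('i \<Rightarrow> real ^ 'd) \<Rightarrow> (real ^ 'd) set" where
  "zonotope I T = transpose_mult I T ` cube I"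

text \<open>Meant for nonempty compact sets, where all suprema and infima are attained.\<close>

definition hausdorff_distance :: "ereal \<Rightarrow> (real ^ 'd) set \<Rightarrow> (real ^ 'd) set \<Rightarrow> real" where
  "hausdorff_distance q K L =
     max (SUP a\<in>K. INF c\<in>L. lnorm q (a - c)) (SUP c\<in>L. INF a\<in>K. lnorm q (a - c))"

definition attains_max :: "('b \<Rightarrow> real) \<Rightarrow> 'b set \<Rightarrow> bool" where
  "attains_max f A \<longleftrightarrow> (\<exists>x. is_arg_max f (\<lambda>x. x \<in> A) x)"

definition attains_min :: "('b \<Rightarrow> real) \<Rightarrow> 'b set \<Rightarrow> bool" where
  "attains_min f A \<longleftrightarrow> (\<exists>x. is_arg_min f (\<lambda>x. x \<in> A) x)"

end

theory Submission
  imports Defs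
begin

text \<open>Write \<open>\<sigma>\<^sub>K v = max\<^bsub>a \<in> K\<^esub> v \<bullet> a\<close>. Choosing each coefficient in \<open>[0,1]\<close>
  according to the sign of \<open>v \<bullet> t\<^sub>i\<close> shows that the objective is the difference of the support
  functions of the two zonotopes. It then suffices that for compact convex \<open>K\<close> and \<open>L\<close> the maximum
  of \<open>\<sigma>\<^sub>K - \<sigma>\<^sub>L\<close> over the \<open>\<ell>\<^sub>p\<close> unit ball is the largest \<open>\<ell>\<^sub>q\<close> distance from a point of \<open>K\<close> to
  \<open>L\<close>. One inequality is Hoelder's. For the other, separate \<open>L\<close> from the open \<open>\<ell>\<^sub>q\<close> ball around
  \<open>a \<in> K\<close> whose radius is the distance from \<open>a\<close> to \<open>L\<close>, and normalise the normal vector in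
  \<open>\<ell>\<^sub>p\<close>. The absolute value follows by exchanging \<open>K\<close> and \<open>L\<close>.\<close>

section \<open>Dual pairs of norms\<close>

text \<open>Each function is the dual norm of the other, with attained suprema. The geometric
  argument uses only these properties of \<open>lnorm p\<close> and \<open>lnorm q\<close>, so
  finite exponents and the pair 1, \<infinity> are treated together.\<close>

locale dual_norms =
  fixes N M :: "'a::euclidean_space \<Rightarrow> real"
  assumes N_nonneg: "0 \<le> N w" and M_nonneg: "0 \<le> M x"
    and N_minus: "N (- w) = N w" and M_minus: "M (- x) = M x"
    and hoelder: "w \<bullet> x \<le> N w * M x"
    and N_attained: "\<exists>x. M x \<le> 1 \<and> w \<bullet> x = N w"
    and M_attained: "\<exists>w. N w \<le> 1 \<and> w \<bullet> x = M x"
begin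

text \<open>The axioms are symmetric in \<open>N\<close> and \<open>M\<close>, so every fact derived
  for \<open>M\<close> transfers to \<open>N\<close>.\<close>

lemma dual_norms_commute: "dual_norms M N"
proof
  show "w \<bullet> x \<le> M w * N x" for w x
    using hoelder[of x w] by (simp add: inner_commute mult.commute)
  show "\<exists>x. N x \<le> 1 \<and> w \<bullet> x = M w" for w
    using M_attained[of w] by (simp add: inner_commute)
  show "\<exists>w. M w \<le> 1 \<and> w \<bullet> x = N x" for x
    using N_attained[of x] by (simp add: inner_commute)
qed (simp_all add: N_nonneg M_nonneg N_minus M_minus)

lemma hoelder_le_M: "N w \<le> 1 \<Longrightarrow> w \<bullet> x \<le> M x"
  using hoelder[of w x] mult_right_mono[of "N w" 1 "M x"] M_nonneg[of x] by simp

lemma M_zero: "M 0 = 0"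
  using M_attained[of 0] by auto

text \<open>By duality \<open>M\<close> is a maximum of linear functionals; evaluate one that
  attains it at the combination. Arbitrary nonnegative coefficients are allowed so that both
  convexity and the bound \<open>M_scaleR_le\<close> follow.\<close>

lemma M_convex_comb:
  assumes "0 \<le> u" "0 \<le> v"
  shows "M (u *\<^sub>R x + v *\<^sub>R y) \<le> u * M x + v * M y"
proof -
  obtain w where w: "N w \<le> 1" "w \<bullet> (u *\<^sub>R x + v *\<^sub>R y) = M (u *\<^sub>R x + v *\<^sub>R y)"
    using M_attained by blast
  have "w \<bullet> (u *\<^sub>R x + v *\<^sub>R y) = u * (w \<bullet> x) + v * (w \<bullet> y)"
    by (simp add: inner_add_right)
  also have "\<dots> \<le> u * M x + v * M y"
    using assms w(1) by (intro add_mono mult_left_mono hoelder_le_M)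
  finally show ?thesis using w(2) by simp
qed

lemma M_scaleR_le: "0 \<le> u \<Longrightarrow> M (u *\<^sub>R x) \<le> u * M x"
  using M_convex_comb[of u 0 x 0] by simp

lemma convex_on_M: "convex_on UNIV M"
  by (rule convex_onI) (auto intro: M_convex_comb)

lemma continuous_on_M: "continuous_on S M"
  using convex_on_continuous[OF open_UNIV convex_on_M] continuous_on_subset by blast

lemma continuous_on_N: "continuous_on S N"
  by (rule dual_norms.continuous_on_M[OF dual_norms_commute])

lemma compact_unit_ball: "compact {w. N w \<le> 1}"
proof -
  have "closed {w. N w \<le> 1}"
    by (intro closed_Collect_le continuous_on_N continuous_on_const)
  \<comment> \<open>Hoelder against each basis vector and its negative bounds every coordinate of
    \<open>w\<close>.\<close>
  moreover have "norm w \<le> (\<Sum>b\<in>Basis. M b)" if "N w \<le> 1" for w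
  proof -
    have "\<bar>w \<bullet> b\<bar> \<le> M b" for b
      using hoelder_le_M[OF that, of b] hoelder_le_M[OF that, of "- b"] M_minus[of b] by simp
    then have "(\<Sum>b\<in>Basis. \<bar>w \<bullet> b\<bar>) \<le> (\<Sum>b\<in>Basis. M b)"
      by (rule sum_mono)
    with norm_le_l1[of w] show ?thesis by linarith
  qed
  ultimately show ?thesis
    unfolding compact_eq_bounded_closed bounded_iff by auto
qed

lemma bdd_below_distances: "bdd_below ((\<lambda>c. M (a - c)) ` L)"
  by (rule bdd_belowI[of _ 0]) (auto simp: M_nonneg)

lemma distance_attained:
  assumes "compact L" "L \<noteq> {}"
  obtains c where "c \<in> L" "\<And>x. x \<in> L \<Longrightarrow> M (a - c) \<le> M (a - x)"
    "(INF c\<in>L. M (a - c)) = M (a - c)"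
proof -
  have "continuous_on L (\<lambda>c. M (a - c))"
    by (rule continuous_on_compose2[OF continuous_on_M]) (auto intro!: continuous_intros)
  then obtain c where c: "c \<in> L" "\<And>x. x \<in> L \<Longrightarrow> M (a - c) \<le> M (a - x)"
    using continuous_attains_inf[OF assms] by blast
  moreover have "(INF c\<in>L. M (a - c)) = M (a - c)"
    by (rule cInf_eq_minimum) (use c in auto)
  ultimately show thesis by (rule that)
qed

text \<open>Take a hyperplane separating \<open>L\<close> from the open \<open>M\<close>-ball of
  radius \<open>d\<close> around \<open>a\<close>. Moving from \<open>a\<close> towards the boundary
  of the ball, against the normal \<open>w\<close>, lowers the functional by up to
  \<open>d * N w\<close> without crossing the hyperplane, so \<open>w\<close> separates
  \<open>a\<close> from \<open>L\<close> by at least this amount.\<close>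

lemma distance_le_support_diff:
  assumes L: "convex L" "L \<noteq> {}"
    and support_L: "\<And>v. \<exists>c\<in>L. v \<bullet> c = \<tau> v"
  shows "\<exists>v. N v \<le> 1 \<and> (INF c\<in>L. M (a - c)) \<le> v \<bullet> a - \<tau> v"
proof -
  define d where "d = (INF c\<in>L. M (a - c))"
  have d_le: "d \<le> M (a - c)" if "c \<in> L" for c
    unfolding d_def using bdd_below_distances that by (rule cINF_lower)
  show ?thesis
  proof (cases "d \<le> 0")
    case True
    \<comment> \<open>The zero functional suffices here, since attainment on \<open>L\<close> forces
      \<open>\<tau> 0 = 0\<close>.\<close>
    have "N 0 = 0"
      by (rule dual_norms.M_zero[OF dual_norms_commute])
    with True support_L[of 0] show ?thesis
      by (intro exI[of _ 0]) (auto simp: d_def)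
  next
    case False
    define B where "B = {x. M (x - a) < d}"
    have "convex B"
    proof (rule convexI)
      fix u v :: real and x y :: 'a
      assume *: "x \<in> B" "y \<in> B" "0 \<le> u" "0 \<le> v" "u + v = 1"
      have "(u *\<^sub>R x + v *\<^sub>R y) - (u + v) *\<^sub>R a = u *\<^sub>R (x - a) + v *\<^sub>R (y - a)"
        by (simp add: algebra_simps)
      then have "(u *\<^sub>R x + v *\<^sub>R y) - a = u *\<^sub>R (x - a) + v *\<^sub>R (y - a)"
        using \<open>u + v = 1\<close> by simp
      also have "M \<dots> \<le> u * M (x - a) + v * M (y - a)"
        using * by (intro M_convex_comb)
      also have "\<dots> < d"
        using * by (intro convex_bound_lt) (auto simp: B_def)
      finally show "u *\<^sub>R x + v *\<^sub>R y \<in> B" by (simp add: B_def)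
    qed
    moreover have "a \<in> B"
      using False by (simp add: B_def M_zero)
    moreover have "L \<inter> B = {}"
    proof -
      have "d \<le> M (c - a)" if "c \<in> L" for c
        using d_le[OF that] M_minus[of "c - a"] by simp
      then show ?thesis by (force simp: B_def)
    qed
    ultimately obtain w \<beta> where w: "w \<noteq> 0" "\<And>x. x \<in> L \<Longrightarrow> w \<bullet> x \<le> \<beta>"
        "\<And>x. x \<in> B \<Longrightarrow> \<beta> \<le> w \<bullet> x"
      using separating_hyperplane_sets[of L B] L by blast
    \<comment> \<open>In the \<open>M\<close>-unit ball, \<open>w\<close> is largest at
      \<open>x\<close>. For \<open>s < 1\<close> the point \<open>a - (s * d) *\<^sub>R x\<close>
      stays inside the open ball; the bound for all such \<open>s\<close> then gives the one for
      \<open>s = 1\<close>.\<close>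
    obtain x where x: "M x \<le> 1" "w \<bullet> x = N w"
      using N_attained by blast
    have "s * (d * N w) \<le> w \<bullet> a - \<beta>" if s: "0 < s" "s < 1" for s
    proof -
      have "M ((a - (s * d) *\<^sub>R x) - a) = M ((s * d) *\<^sub>R x)"
        by (simp add: M_minus)
      also have "\<dots> \<le> s * d * M x"
        using s False by (intro M_scaleR_le) simp
      also have "\<dots> \<le> s * d * 1"
        using s False x(1) by (intro mult_left_mono) simp_all
      also have "\<dots> < d"
        using s False by simp
      finally have "\<beta> \<le> w \<bullet> (a - (s * d) *\<^sub>R x)"
        by (intro w(3)) (simp add: B_def)
      then show ?thesis
        using x(2) by (simp add: inner_diff_right algebra_simps)
    qed
    then have le: "d * N w \<le> w \<bullet> a - \<beta>"
      by (rule field_le_mult_one_interval)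
    \<comment> \<open>Hoelder for \<open>w\<close> with itself shows that the nonzero normal has
      positive \<open>N\<close>-norm, so that it can be normalised.\<close>
    have "0 < w \<bullet> w" using w(1) by simp
    also have "\<dots> \<le> N w * M w" by (rule hoelder)
    finally have pos: "0 < N w"
      using N_nonneg[of w] by (simp add: zero_less_mult_iff)
    define v where "v = (1 / N w) *\<^sub>R w"
    have "N v \<le> 1 / N w * N w"
      unfolding v_def using pos
      by (intro dual_norms.M_scaleR_le[OF dual_norms_commute]) simp
    moreover obtain c where c: "c \<in> L" "v \<bullet> c = \<tau> v"
      using support_L by blast
    have "d \<le> (w \<bullet> a - w \<bullet> c) / N w"
      using le w(2)[OF c(1)] pos by (simp add: pos_le_divide_eq)
    then have "d \<le> v \<bullet> a - \<tau> v"
      unfolding c(2)[symmetric] by (simp add: v_def diff_divide_distrib)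
    ultimately show ?thesis
      using pos by (auto simp: d_def)
  qed
qed

text \<open>Let \<open>v\<close> maximise over the compact \<open>N\<close>-ball and let
  \<open>a\<close> be a point of \<open>K\<close> where \<open>v\<close> attains
  \<open>\<sigma> v\<close>. Hoelder at the point of \<open>L\<close> nearest to \<open>a\<close>
  bounds the maximum by the distance from \<open>a\<close> to \<open>L\<close>, while separation
  bounds the distance from every point of \<open>K\<close> by the maximum. Hence \<open>a\<close> is
  a farthest point and both values agree.\<close>

theorem max_support_diff:
  assumes L: "compact L" "convex L" "L \<noteq> {}"
    and support_K: "\<And>v a. a \<in> K \<Longrightarrow> v \<bullet> a \<le> \<sigma> v" "\<And>v. \<exists>a\<in>K. v \<bullet> a = \<sigma> v"
    and support_L: "\<And>v c. c \<in> L \<Longrightarrow> v \<bullet> c \<le> \<tau> v" "\<And>v. \<exists>c\<in>L. v \<bullet> c = \<tau> v"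
    and cont: "continuous_on UNIV (\<lambda>v. \<sigma> v - \<tau> v)"
  obtains v a where "N v \<le> 1" "\<And>w. N w \<le> 1 \<Longrightarrow> \<sigma> w - \<tau> w \<le> \<sigma> v - \<tau> v"
    "a \<in> K" "\<And>x. x \<in> K \<Longrightarrow> (INF c\<in>L. M (x - c)) \<le> (INF c\<in>L. M (a - c))"
    "\<sigma> v - \<tau> v = (INF c\<in>L. M (a - c))"
proof -
  have "N 0 = 0"
    by (rule dual_norms.M_zero[OF dual_norms_commute])
  then have "{w. N w \<le> 1} \<noteq> {}" by (auto intro: exI[of _ 0])
  then obtain v where v: "N v \<le> 1" "\<And>w. N w \<le> 1 \<Longrightarrow> \<sigma> w - \<tau> w \<le> \<sigma> v - \<tau> v"
    using continuous_attains_sup[OF compact_unit_ball _ continuous_on_subset[OF cont]] by auto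
  obtain a where a: "a \<in> K" "v \<bullet> a = \<sigma> v"
    using support_K(2) by blast
  obtain c where c: "c \<in> L" "(INF c\<in>L. M (a - c)) = M (a - c)"
    using distance_attained[OF L(1,3)] by metis
  have "\<sigma> v - \<tau> v \<le> v \<bullet> (a - c)"
    using a(2) support_L(1)[OF c(1), of v] by (simp add: inner_diff_right)
  also have "\<dots> \<le> M (a - c)"
    using v(1) by (rule hoelder_le_M)
  finally have ge: "\<sigma> v - \<tau> v \<le> (INF c\<in>L. M (a - c))"
    using c(2) by simp
  have le: "(INF c\<in>L. M (x - c)) \<le> \<sigma> v - \<tau> v" if x: "x \<in> K" for x
  proof -
    obtain w where w: "N w \<le> 1" "(INF c\<in>L. M (x - c)) \<le> w \<bullet> x - \<tau> w"
      using distance_le_support_diff[OF L(2,3) support_L(2)] by metis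
    with support_K(1)[OF x, of w] v(2)[OF w(1)] show ?thesis by linarith
  qed
  show thesis
    using v a(1) order_trans[OF le ge] antisym[OF ge le[OF a(1)]] by (rule that)
qed

end

section \<open>Conjugate exponents\<close>

lemma lnorm_real: "lnorm (ereal r) x = (\<Sum>j\<in>UNIV. \<bar>x $ j\<bar> powr r) powr (1 / r)"
  by (simp add: lnorm_def)

lemma lnorm_one: "lnorm 1 x = (\<Sum>j\<in>UNIV. \<bar>x $ j\<bar>)"
  by (simp add: lnorm_def sum_nonneg)

lemma lnorm_infinity: "lnorm \<infinity> x = infnorm x"
  by (simp add: lnorm_def)

lemma lnorm_nonneg: "0 \<le> lnorm r x"
  by (simp add: lnorm_def infnorm_pos_le)

lemma lnorm_minus: "lnorm r (- x) = lnorm r x"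
  by (simp add: lnorm_def infnorm_neg)

lemma lnorm_powr:
  assumes "0 < r"
  shows "lnorm (ereal r) x powr r = (\<Sum>j\<in>UNIV. \<bar>x $ j\<bar> powr r)"
  using assms by (simp add: lnorm_real powr_powr sum_nonneg)

lemma lnorm_eq_0:
  assumes "0 < r" "lnorm (ereal r) x = 0"
  shows "x = 0"
proof -
  have "(\<Sum>j\<in>UNIV. \<bar>x $ j\<bar> powr r) = 0"
    using lnorm_powr[OF assms(1), of x] assms by simp
  then show ?thesis
    by (simp add: sum_nonneg_eq_0_iff vec_eq_iff)
qed

text \<open>After scaling both vectors to norm 1, Young's inequality in each coordinate sums to
  \<open>1 / p + 1 / q = 1\<close>.\<close>

lemma hoelder_real:
  fixes x w :: "real ^ 'd"
  assumes pq: "1 < p" "1 < q" "1 / p + 1 / q = 1"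
  shows "w \<bullet> x \<le> lnorm (ereal p) w * lnorm (ereal q) x"
proof (cases "w = 0 \<or> x = 0")
  case True
  then show ?thesis by (auto simp: lnorm_nonneg)
next
  case False
  define A B where "A = lnorm (ereal p) w" and "B = lnorm (ereal q) x"
  have AB: "0 < A" "0 < B"
    using False lnorm_eq_0[of p w] lnorm_eq_0[of q x] lnorm_nonneg[of "ereal p" w]
      lnorm_nonneg[of "ereal q" x] pq
    by (auto simp: A_def B_def order_less_le)
  have "w \<bullet> x \<le> (\<Sum>j\<in>UNIV. \<bar>w $ j\<bar> * \<bar>x $ j\<bar>)"
    unfolding inner_vec_def by (intro sum_mono) (simp add: flip: abs_mult)
  also have "\<dots> = A * B * (\<Sum>j\<in>UNIV. (\<bar>w $ j\<bar> / A) * (\<bar>x $ j\<bar> / B))"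
    using AB by (simp add: sum_distrib_left)
  also have "\<dots> \<le> A * B * (\<Sum>j\<in>UNIV. (\<bar>w $ j\<bar> / A) powr p / p + (\<bar>x $ j\<bar> / B) powr q / q)"
    using AB pq by (intro mult_left_mono sum_mono Youngs_inequality) auto
  also have "(\<Sum>j\<in>UNIV. (\<bar>w $ j\<bar> / A) powr p / p + (\<bar>x $ j\<bar> / B) powr q / q)
      = (\<Sum>j\<in>UNIV. \<bar>w $ j\<bar> powr p) / A powr p / p + (\<Sum>j\<in>UNIV. \<bar>x $ j\<bar> powr q) / B powr q / q"
    using AB by (simp add: powr_divide sum.distrib sum_divide_distrib)
  also have "\<dots> = 1"
  proof -
    have "(\<Sum>j\<in>UNIV. \<bar>w $ j\<bar> powr p) = A powr p" "(\<Sum>j\<in>UNIV. \<bar>x $ j\<bar> powr q) = B powr q"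
      using pq by (simp_all add: A_def B_def lnorm_powr)
    then show ?thesis using AB pq by simp
  qed
  finally show ?thesis by (simp add: A_def B_def)
qed

lemma lnorm_attained_real:
  fixes w :: "real ^ 'd"
  assumes pq: "1 < p" "1 < q" "1 / p + 1 / q = 1"
  shows "\<exists>x. lnorm (ereal q) x \<le> 1 \<and> w \<bullet> x = lnorm (ereal p) w"
proof (cases "w = 0")
  case True
  then show ?thesis
    using pq by (intro exI[of _ 0]) (simp add: lnorm_real)
next
  case False
  define A where "A = lnorm (ereal p) w"
  have A: "0 < A"
    using False lnorm_eq_0[of p w] lnorm_nonneg[of "ereal p" w] pq
    by (auto simp: A_def order_less_le)
  have A_powr: "A powr p = (\<Sum>j\<in>UNIV. \<bar>w $ j\<bar> powr p)"
    using lnorm_powr[of p w] pq by (simp add: A_def)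
  have exponent: "(p - 1) * q = p"
    using pq by (simp add: field_simps)
  \<comment> \<open>This is the equality case of Hoelder: by \<open>exponent\<close>,
    \<open>\<bar>x $ j\<bar> powr q\<close> is proportional to
    \<open>\<bar>w $ j\<bar> powr p\<close>, and dividing by \<open>A\<close> makes these powers sum
    to 1.\<close>
  define x :: "real ^ 'd" where "x = (\<chi> j. sgn (w $ j) * (\<bar>w $ j\<bar> / A) powr (p - 1))"
  have "\<bar>x $ j\<bar> powr q = \<bar>w $ j\<bar> powr p / A powr p" for j
    using A exponent by (auto simp: x_def abs_mult abs_sgn_eq powr_powr powr_divide)
  then have "(\<Sum>j\<in>UNIV. \<bar>x $ j\<bar> powr q) = 1"
    using A by (simp flip: sum_divide_distrib A_powr)
  moreover have "w $ j * x $ j = \<bar>w $ j\<bar> powr p / A powr (p - 1)" for j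
  proof -
    have "w $ j * x $ j = (\<bar>w $ j\<bar> * \<bar>w $ j\<bar> powr (p - 1)) / A powr (p - 1)"
      using A by (simp add: x_def powr_divide flip: abs_sgn mult.assoc)
    then show ?thesis by (simp add: powr_mult_base)
  qed
  then have "w \<bullet> x = A powr p / A powr (p - 1)"
    by (simp add: inner_vec_def A_powr flip: sum_divide_distrib)
  then have "w \<bullet> x = A"
    using A by (simp flip: powr_diff)
  ultimately show ?thesis
    by (intro exI[of _ x]) (simp add: lnorm_real A_def)
qed

lemma dual_norms_real:
  assumes "1 < p" "1 < q" "1 / p + 1 / q = 1"
  shows "dual_norms (lnorm (ereal p) :: real ^ 'd \<Rightarrow> real) (lnorm (ereal q))"
proof
  show "\<exists>x. lnorm (ereal q) x \<le> 1 \<and> w \<bullet> x = lnorm (ereal p) w" for w :: "real ^ 'd"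
    using assms by (rule lnorm_attained_real)
  show "\<exists>w. lnorm (ereal p) w \<le> 1 \<and> w \<bullet> x = lnorm (ereal q) x" for x :: "real ^ 'd"
    using lnorm_attained_real[of q p x] assms by (simp add: inner_commute add.commute)
qed (use assms in \<open>simp_all add: lnorm_nonneg lnorm_minus hoelder_real\<close>)

lemma infnorm_attained: "\<exists>j. infnorm (x :: real ^ 'd) = \<bar>x $ j\<bar>"
proof -
  have "Max (range (\<lambda>j. \<bar>x $ j\<bar>)) \<in> range (\<lambda>j. \<bar>x $ j\<bar>)"
    by (rule Max_in) auto
  moreover have "infnorm x = Max (range (\<lambda>j. \<bar>x $ j\<bar>))"
    unfolding infnorm_cart by (subst cSup_eq_Max[symmetric]) (auto simp: full_SetCompr_eq)
  ultimately have "infnorm x \<in> range (\<lambda>j. \<bar>x $ j\<bar>)" by simp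
  then show ?thesis by blast
qed

text \<open>The extremal vectors are the sign vector of \<open>w\<close> for the sum norm, and a
  signed unit vector at a coordinate of largest modulus for the maximum norm.\<close>

lemma dual_norms_one_infinity: "dual_norms (lnorm 1 :: real ^ 'd \<Rightarrow> real) (lnorm \<infinity>)"
proof
  fix w x :: "real ^ 'd"
  have "w \<bullet> x \<le> (\<Sum>j\<in>UNIV. \<bar>w $ j\<bar> * infnorm x)"
    unfolding inner_vec_def
  proof (rule sum_mono)
    fix j
    have "w $ j * x $ j \<le> \<bar>w $ j\<bar> * \<bar>x $ j\<bar>"
      by (simp flip: abs_mult)
    also have "\<dots> \<le> \<bar>w $ j\<bar> * infnorm x"
      by (intro mult_left_mono component_le_infnorm_cart) simp
    finally show "w $ j \<bullet> x $ j \<le> \<bar>w $ j\<bar> * infnorm x" by simp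
  qed
  then show "w \<bullet> x \<le> lnorm 1 w * lnorm \<infinity> x"
    by (simp add: lnorm_one lnorm_infinity sum_distrib_right)
  define s :: "real ^ 'd" where "s = (\<chi> j. sgn (w $ j))"
  have "lnorm \<infinity> s \<le> 1"
    using infnorm_attained[of s] by (auto simp: lnorm_infinity s_def abs_sgn_eq)
  moreover have "w \<bullet> s = lnorm 1 w"
    by (simp add: s_def inner_vec_def lnorm_one flip: abs_sgn)
  ultimately show "\<exists>x. lnorm \<infinity> x \<le> 1 \<and> w \<bullet> x = lnorm 1 w" by blast
  obtain j where j: "infnorm x = \<bar>x $ j\<bar>"
    using infnorm_attained by blast
  have "lnorm 1 (axis j (sgn (x $ j))) \<le> 1"
    by (simp add: lnorm_one axis_def if_distrib[of abs] abs_sgn_eq cong: if_cong)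
  moreover have "axis j (sgn (x $ j)) \<bullet> x = lnorm \<infinity> x"
    by (simp add: inner_axis' j lnorm_infinity abs_sgn mult.commute)
  ultimately show "\<exists>w. lnorm 1 w \<le> 1 \<and> w \<bullet> x = lnorm \<infinity> x" by blast
qed (simp_all add: lnorm_nonneg lnorm_minus)

lemma dual_norms_conjugate:
  fixes p q :: ereal
  assumes "1 \<le> p" "p \<le> 2" "2 \<le> q" "1 / p + 1 / q = 1"
  shows "dual_norms (lnorm p :: real ^ 'd \<Rightarrow> real) (lnorm q)"
proof -
  obtain r where r: "p = ereal r" "1 \<le> r" "r \<le> 2"
    using assms(1,2) by (cases p) auto
  show ?thesis
  proof (cases q)
    case (real s)
    then have s: "2 \<le> s" using assms(3) by simp
    then have rs: "1 / r + 1 / s = 1"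
      using assms(4) r(2) by (simp add: r(1) real one_ereal_def divide_ereal_def inverse_eq_divide)
    \<comment> \<open>The exponent 1 would force \<open>1 / s = 0\<close>, which is impossible for
      finite \<open>s\<close>.\<close>
    have "r \<noteq> 1" using rs s by auto
    with r rs s show ?thesis
      unfolding real r(1) by (intro dual_norms_real) auto
  next
    case PInf
    then have "r = 1"
      using assms(4) r by (simp add: one_ereal_def divide_ereal_def)
    with PInf r(1) dual_norms_one_infinity show ?thesis
      by (simp add: one_ereal_def)
  next
    case MInf
    then show ?thesis using assms(3) by simp
  qed
qed

section \<open>Zonotopes\<close>

lemma transpose_mult_eq_sum: "transpose_mult I T b = (\<Sum>i\<in>I. b i *\<^sub>R T i)"
  by (simp add: transpose_mult_def vec_eq_iff mult.commute)

lemma cube_nonempty: "cube I \<noteq> {}"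
  by (auto simp: cube_def PiE_eq_empty_iff)

lemma zonotope_nonempty: "zonotope I T \<noteq> {}"
  by (simp add: zonotope_def cube_nonempty)

text \<open>Splitting off one generator exhibits a Minkowski sum with a segment. The double union is
  the form in which \<open>compact_sums'\<close> and \<open>convex_sums\<close> are stated, for
  induction over the generators.\<close>

lemma zonotope_insert:
  assumes "finite I" "i \<notin> I"
  shows "zonotope (insert i I) T
    = (\<Union>x\<in>closed_segment 0 (T i). \<Union>y\<in>zonotope I T. {x + y})" (is "?A = ?B")
proof
  show "?A \<subseteq> ?B"
  proof
    fix x assume "x \<in> ?A"
    then obtain b where b: "b \<in> cube (insert i I)" "x = transpose_mult (insert i I) T b"
      by (auto simp: zonotope_def)
    \<comment> \<open>Members of \<open>cube I\<close> are extensional, so \<open>b\<close> has to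
      be cut down to \<open>I\<close>.\<close>
    have "restrict b I \<in> cube I"
      using b(1) by (auto simp: cube_def)
    moreover have "transpose_mult I T b = transpose_mult I T (restrict b I)"
      by (simp add: transpose_mult_eq_sum)
    ultimately have "transpose_mult I T b \<in> zonotope I T"
      by (auto simp: zonotope_def)
    moreover have "b i *\<^sub>R T i \<in> closed_segment 0 (T i)"
      using PiE_mem[of b "insert i I" "\<lambda>_. {0..1}" i] b(1)
      by (auto simp: closed_segment_def cube_def intro!: exI[of _ "b i"])
    moreover have "x = b i *\<^sub>R T i + transpose_mult I T b"
      using assms b(2) by (simp add: transpose_mult_eq_sum)
    ultimately show "x \<in> ?B" by blast
  qed
  show "?B \<subseteq> ?A"
  proof
    fix x assume "x \<in> ?B"
    then obtain u b where ub: "0 \<le> u" "u \<le> 1" "b \<in> cube I"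
        "x = u *\<^sub>R T i + transpose_mult I T b"
      by (auto simp: zonotope_def closed_segment_def)
    have "b(i := u) \<in> cube (insert i I)"
      using ub by (auto simp: cube_def PiE_def extensional_def)
    moreover have "(\<Sum>k\<in>I. (b(i := u)) k *\<^sub>R T k) = (\<Sum>k\<in>I. b k *\<^sub>R T k)"
      by (rule sum.cong) (use assms in auto)
    then have "x = transpose_mult (insert i I) T (b(i := u))"
      using assms ub(4) by (simp add: transpose_mult_eq_sum del: fun_upd_apply) simp
    ultimately show "x \<in> ?A"
      unfolding zonotope_def by blast
  qed
qed

lemma compact_convex_zonotope:
  assumes "finite I"
  shows "compact (zonotope I T) \<and> convex (zonotope I T)"
  using assms
proof (induction I)
  case empty
  then show ?case by (simp add: zonotope_def cube_def transpose_mult_eq_sum)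
next
  case (insert i I)
  then show ?case
    unfolding zonotope_insert[OF insert.hyps]
    by (intro conjI compact_sums' convex_sums compact_segment convex_closed_segment) auto
qed

lemma zonotope_support_le:
  assumes "a \<in> zonotope I T"
  shows "v \<bullet> a \<le> (\<Sum>i\<in>I. max (v \<bullet> T i) 0)"
proof -
  obtain b where b: "b \<in> cube I" "a = transpose_mult I T b"
    using assms by (auto simp: zonotope_def)
  have "v \<bullet> a = (\<Sum>i\<in>I. b i * (v \<bullet> T i))"
    by (simp add: b(2) transpose_mult_eq_sum inner_sum_right)
  also have "\<dots> \<le> (\<Sum>i\<in>I. max (v \<bullet> T i) 0)"
  proof (rule sum_mono)
    fix i assume "i \<in> I"
    then have bi: "0 \<le> b i" "b i \<le> 1" using b(1) by (auto simp: cube_def)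
    have "b i * (v \<bullet> T i) \<le> b i * max (v \<bullet> T i) 0"
      using bi by (intro mult_left_mono) auto
    also have "\<dots> \<le> 1 * max (v \<bullet> T i) 0"
      using bi by (intro mult_right_mono) auto
    finally show "b i * (v \<bullet> T i) \<le> max (v \<bullet> T i) 0" by simp
  qed
  finally show ?thesis .
qed

lemma zonotope_support_attained: "\<exists>a\<in>zonotope I T. v \<bullet> a = (\<Sum>i\<in>I. max (v \<bullet> T i) 0)"
proof
  \<comment> \<open>Taking coefficient 1 exactly where the inner product is positive turns each
    summand into its positive part.\<close>
  define b where "b = (\<lambda>i\<in>I. if 0 < v \<bullet> T i then 1 else 0 :: real)"
  have "b \<in> cube I"
    by (auto simp: b_def cube_def)
  then show "transpose_mult I T b \<in> zonotope I T"
    by (simp add: zonotope_def)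
  show "v \<bullet> transpose_mult I T b = (\<Sum>i\<in>I. max (v \<bullet> T i) 0)"
    unfolding transpose_mult_eq_sum inner_sum_right
    by (rule sum.cong) (auto simp: b_def)
qed

section \<open>The incremental problem\<close>

lemma attains_maxI: "x \<in> A \<Longrightarrow> (\<And>y. y \<in> A \<Longrightarrow> f y \<le> f x) \<Longrightarrow> attains_max f A"
  unfolding attains_max_def is_arg_max_def by (meson not_less)

lemma attains_minI: "x \<in> A \<Longrightarrow> (\<And>y. y \<in> A \<Longrightarrow> f x \<le> f y) \<Longrightarrow> attains_min f A"
  unfolding attains_min_def is_arg_min_def by (meson not_less)

lemma SUP_eq_maximum:
  fixes f :: "'b \<Rightarrow> real"
  shows "x \<in> A \<Longrightarrow> (\<And>y. y \<in> A \<Longrightarrow> f y \<le> f x) \<Longrightarrow> (SUP y\<in>A. f y) = f x"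
  by (rule cSup_eq_maximum) auto

text \<open>Over the reals \<open>SUP\<close> and \<open>INF\<close> are meaningful only for bounded
  nonempty families, so the attainment and compactness claims accompany the equations and make these
  values true maxima and minima.\<close>

theorem mainTheorem12:
  fixes p q :: ereal and n :: nat
    and z t :: "nat \<Rightarrow> real ^ 'd" and y :: "nat \<Rightarrow> real"
    and Ip Im :: "nat set" and F :: "real ^ 'd \<Rightarrow> real"
  assumes "1 \<le> p" "p \<le> 2" "2 \<le> q" "1 / p + 1 / q = 1"
  defines "Ip \<equiv> {i \<in> {1..n}. y i \<ge> 0}"
    and "Im \<equiv> {i \<in> {1..n}. y i < 0}"
    and "t \<equiv> \<lambda>i. \<bar>y i\<bar> *\<^sub>R z i"
    and "F \<equiv> \<lambda>v. \<Sum>i=1..n. y i * max (v \<bullet> z i) 0"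
  shows
    "attains_max F {v. lnorm p v \<le> 1}
     \<and> (\<forall>b\<in>cube Ip. attains_min
           (\<lambda>c. lnorm q (transpose_mult Ip t b - transpose_mult Im t c)) (cube Im))
     \<and> attains_max
           (\<lambda>b. INF c\<in>cube Im. lnorm q (transpose_mult Ip t b - transpose_mult Im t c)) (cube Ip)
     \<and> (SUP v\<in>{v. lnorm p v \<le> 1}. F v)
       = (SUP b\<in>cube Ip. INF c\<in>cube Im.
             lnorm q (transpose_mult Ip t b - transpose_mult Im t c))
     \<and> compact (zonotope Ip t) \<and> compact (zonotope Im t)
     \<and> attains_max (\<lambda>v. \<bar>F v\<bar>) {v. lnorm p v \<le> 1}
     \<and> (SUP v\<in>{v. lnorm p v \<le> 1}. \<bar>F v\<bar>)
       = hausdorff_distance q (zonotope Ip t) (zonotope Im t)"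
proof -
  interpret dual_norms "lnorm p :: real ^ 'd \<Rightarrow> real" "lnorm q"
    by (rule dual_norms_conjugate) fact+
  define K L where "K = zonotope Ip t" and "L = zonotope Im t"
  define \<sigma> \<tau> where "\<sigma> v = (\<Sum>i\<in>Ip. max (v \<bullet> t i) 0)" and "\<tau> v = (\<Sum>i\<in>Im. max (v \<bullet> t i) 0)"
    for v :: "real ^ 'd"
  have K: "compact K" "convex K" "K \<noteq> {}" and L: "compact L" "convex L" "L \<noteq> {}"
    unfolding K_def L_def Ip_def Im_def
    by (simp_all add: compact_convex_zonotope zonotope_nonempty)
  have F_eq: "F v = \<sigma> v - \<tau> v" for v
  proof -
    \<comment> \<open>The factor \<open>\<bar>y i\<bar>\<close> is nonnegative and passes through
      the maximum; the sign of \<open>y i\<close> then decides whether the term belongs to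
      \<open>\<sigma>\<close> or to \<open>- \<tau>\<close>.\<close>
    have max_scale: "max (v \<bullet> t i) 0 = \<bar>y i\<bar> * max (v \<bullet> z i) 0" for i
      by (simp add: t_def max_mult_distrib_left)
    have "{1..n} = Ip \<union> Im" "Ip \<inter> Im = {}" "finite Ip" "finite Im"
      by (auto simp: Ip_def Im_def)
    then have "F v = (\<Sum>i\<in>Ip. y i * max (v \<bullet> z i) 0) + (\<Sum>i\<in>Im. y i * max (v \<bullet> z i) 0)"
      unfolding F_def by (simp add: sum.union_disjoint)
    also have "(\<Sum>i\<in>Ip. y i * max (v \<bullet> z i) 0) = \<sigma> v"
      unfolding \<sigma>_def max_scale by (rule sum.cong) (auto simp: Ip_def)
    also have "(\<Sum>i\<in>Im. y i * max (v \<bullet> z i) 0) = - \<tau> v"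
      unfolding \<tau>_def max_scale sum_negf[symmetric] by (rule sum.cong) (auto simp: Im_def)
    finally show ?thesis by simp
  qed
  have cont: "continuous_on UNIV (\<lambda>v. \<sigma> v - \<tau> v)" "continuous_on UNIV (\<lambda>v. \<tau> v - \<sigma> v)"
    unfolding \<sigma>_def \<tau>_def by (intro continuous_intros)+
  have support_K: "\<And>v a. a \<in> K \<Longrightarrow> v \<bullet> a \<le> \<sigma> v" "\<And>v. \<exists>a\<in>K. v \<bullet> a = \<sigma> v"
    and support_L: "\<And>v c. c \<in> L \<Longrightarrow> v \<bullet> c \<le> \<tau> v" "\<And>v. \<exists>c\<in>L. v \<bullet> c = \<tau> v"
    unfolding K_def L_def \<sigma>_def \<tau>_def
    by (simp_all only: zonotope_support_le zonotope_support_attained)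
  obtain v a where v: "lnorm p v \<le> 1" "\<And>w. lnorm p w \<le> 1 \<Longrightarrow> \<sigma> w - \<tau> w \<le> \<sigma> v - \<tau> v"
    and a: "a \<in> K" "\<And>x. x \<in> K \<Longrightarrow> (INF c\<in>L. lnorm q (x - c)) \<le> (INF c\<in>L. lnorm q (a - c))"
    and va: "\<sigma> v - \<tau> v = (INF c\<in>L. lnorm q (a - c))"
    using max_support_diff[OF L support_K support_L cont(1)] by blast
  \<comment> \<open>Exchanging the zonotopes gives the maximum of \<open>- F\<close> and the other
    one-sided distance.\<close>
  obtain v' a' where v': "lnorm p v' \<le> 1" "\<And>w. lnorm p w \<le> 1 \<Longrightarrow> \<tau> w - \<sigma> w \<le> \<tau> v' - \<sigma> v'"
    and a': "a' \<in> L" "\<And>x. x \<in> L \<Longrightarrow> (INF c\<in>K. lnorm q (x - c)) \<le> (INF c\<in>K. lnorm q (a' - c))"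
    and va': "\<tau> v' - \<sigma> v' = (INF c\<in>K. lnorm q (a' - c))"
    using max_support_diff[OF K support_L support_K cont(2)] by blast
  have SUP_K: "(SUP a\<in>K. INF c\<in>L. lnorm q (a - c)) = \<sigma> v - \<tau> v"
    unfolding va using a by (rule SUP_eq_maximum)
  have SUP_L: "(SUP c\<in>L. INF a\<in>K. lnorm q (a - c)) = \<tau> v' - \<sigma> v'"
  proof -
    \<comment> \<open>Both halves of \<open>hausdorff_distance\<close> use the difference
      \<open>a - c\<close>, whereas the exchanged result has \<open>c - a\<close>; the norm is
      even.\<close>
    have "lnorm q (a - c) = lnorm q (c - a)" for a c :: "real ^ 'd"
      using M_minus[of "a - c"] by simp
    then have "(INF a\<in>K. lnorm q (a - c)) = (INF a\<in>K. lnorm q (c - a))" for c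
      by (intro INF_cong refl)
    then show ?thesis
      unfolding va' by (simp only:) (use a' in \<open>rule SUP_eq_maximum\<close>)
  qed
  have INF_cube: "(INF c\<in>cube Im. lnorm q (x - transpose_mult Im t c))
      = (INF c\<in>L. lnorm q (x - c))" for x
    by (simp add: L_def zonotope_def image_image)
  obtain b where b: "b \<in> cube Ip" "a = transpose_mult Ip t b"
    using a(1) by (auto simp: K_def zonotope_def)
  have "attains_max F {v. lnorm p v \<le> 1}"
    using v by (intro attains_maxI[of v]) (auto simp: F_eq)
  moreover have "attains_min (\<lambda>c. lnorm q (x - transpose_mult Im t c)) (cube Im)" for x
  proof -
    obtain c where "c \<in> L" and c_min: "\<And>x'. x' \<in> L \<Longrightarrow> lnorm q (x - c) \<le> lnorm q (x - x')"
      using distance_attained[OF L(1,3)] by metis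
    then obtain e where e: "e \<in> cube Im" "c = transpose_mult Im t e"
      by (auto simp: L_def zonotope_def)
    show ?thesis
      using e(1) by (rule attains_minI) (use c_min in \<open>auto simp: e(2) L_def zonotope_def\<close>)
  qed
  moreover have "attains_max (\<lambda>b. INF c\<in>cube Im.
      lnorm q (transpose_mult Ip t b - transpose_mult Im t c)) (cube Ip)"
    unfolding INF_cube using b(1)
    by (rule attains_maxI) (use a(2) in \<open>auto simp: b(2) K_def zonotope_def\<close>)
  moreover have "(SUP v\<in>{v. lnorm p v \<le> 1}. F v)
      = (SUP b\<in>cube Ip. INF c\<in>cube Im. lnorm q (transpose_mult Ip t b - transpose_mult Im t c))"
  proof -
    have "(SUP v\<in>{v. lnorm p v \<le> 1}. F v) = \<sigma> v - \<tau> v"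
      using SUP_eq_maximum[of v "{v. lnorm p v \<le> 1}" F] v by (simp add: F_eq)
    also have "\<dots> = (SUP b\<in>cube Ip. INF c\<in>L. lnorm q (transpose_mult Ip t b - c))"
      unfolding SUP_K[symmetric] by (simp add: K_def zonotope_def image_image)
    finally show ?thesis by (simp only: INF_cube)
  qed
  \<comment> \<open>The larger of the maxima of \<open>F\<close> and \<open>- F\<close> bounds
    \<open>\<bar>F w\<bar>\<close> on the unit ball, and the corresponding maximiser attains
    it.\<close>
  moreover obtain u where u: "lnorm p u \<le> 1" "\<And>w. lnorm p w \<le> 1 \<Longrightarrow> \<bar>F w\<bar> \<le> \<bar>F u\<bar>"
    "\<bar>F u\<bar> = max (\<sigma> v - \<tau> v) (\<tau> v' - \<sigma> v')"
  proof (cases "\<sigma> v - \<tau> v \<le> \<tau> v' - \<sigma> v'")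
    case True
    then have le: "\<bar>F w\<bar> \<le> \<tau> v' - \<sigma> v'" if "lnorm p w \<le> 1" for w
      using v(2)[OF that] v'(2)[OF that] by (auto simp: F_eq)
    have "\<bar>F v'\<bar> = \<tau> v' - \<sigma> v'"
      using le[OF v'(1)] F_eq[of v'] by linarith
    with v'(1) le True show thesis
      by (intro that[of v']) auto
  next
    case False
    then have le: "\<bar>F w\<bar> \<le> \<sigma> v - \<tau> v" if "lnorm p w \<le> 1" for w
      using v(2)[OF that] v'(2)[OF that] by (auto simp: F_eq)
    have "\<bar>F v\<bar> = \<sigma> v - \<tau> v"
      using le[OF v(1)] F_eq[of v] by linarith
    with v(1) le False show thesis
      by (intro that[of v]) auto
  qed
  have "attains_max (\<lambda>v. \<bar>F v\<bar>) {v. lnorm p v \<le> 1}"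
    using u by (intro attains_maxI[of u]) auto
  moreover have "(SUP v\<in>{v. lnorm p v \<le> 1}. \<bar>F v\<bar>) = hausdorff_distance q K L"
    using SUP_eq_maximum[of u "{v. lnorm p v \<le> 1}" "\<lambda>v. \<bar>F v\<bar>"] u
    by (simp add: hausdorff_distance_def SUP_K SUP_L)
  ultimately show ?thesis
    using K(1) L(1) by (simp add: K_def L_def)
qed

end
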